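(* Let $m$ be an even integer, $n$ an odd integer, and $d$ an integer. Then: 1. If $n\geq 3$, then $\tau_{d}(P_2\square C_n)=3d$ whenever $1\leq d\leq n$. 2. If $m\geq 4$ and $n\geq 3$, then: (a) $\tau_{d}(P_m\square C_n)=3d$ whenever $1\leq d\leq n-1$; (b) $4d-n-\min\left\{\left\lfloor \frac{d-n}{n-2}\right\rfloor, \left\lfloor\frac{mn-2d}{2n-2}\right\rfloor\right\} \leq \tau_{d}(P_m\square C_n)\leq 4d-n+1$ whenever $n\leq d\leq n+\frac{m}{2}-2$; (c) $4d-n-\min\left\{\left\lfloor \frac{d-n}{n-2}\right\rfloor, \left\lfloor\frac{mn-2d}{2n-2}\right\rfloor\right\} \leq \tau_{d}(P_m\square C_n)\leq 4d-n$ whenever $n+\frac{m}{2}-1\leq d< \frac{mn}{2}$; (d) $\tau_{\frac{mn}{2}}(P_m\square C_n)=2mn-n$.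
   Context: All graphs are simple, finite and undirected. A matching of a graph $G$ is a set of edges no two of which share an endpoint; a maximum matching is a matching of largest cardinality, and this cardinality is denoted $\nu(G)$. For an integer $d$ with $1\leq d\leq \nu(G)$, a $d$-transversal set of $G$ is a set $T\subseteq E(G)$ such that $|T\cap M|\geq d$ for every maximum matching $M$ of $G$; $\tau_d(G)$ denotes the minimum cardinality of a $d$-transversal set of $G$. $P_m$ is the path with $m$ vertices, $C_n$ is the cycle with $n$ vertices ($n\ge 3$). The Cartesian product $G\square H$ has vertex set $V(G)\times V(H)$, with $(g_1,h_1)$ and $(g_2,h_2)$ adjacent iff either $g_1=g_2$ and $h_1h_2\in E(H)$, or $g_1g_2\in E(G)$ and $h_1=h_2$. $\lfloor x\rfloor$ is the greatest integer not greater than $x$. *)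

theory Defs
  imports Complex_Main
begin

record 'a ugraph =
  verts :: "'a set"
  edges :: "'a set set"

text \<open>An edge is the two-element set of its endpoints, so loops and multiple edges are excluded.\<close>

definition simple_graph :: "'a ugraph \<Rightarrow> bool" where
  "simple_graph G \<longleftrightarrow> finite (verts G) \<and> (\<forall>e\<in>edges G. e \<subseteq> verts G \<and> card e = 2)"

definition matching :: "'a ugraph \<Rightarrow> 'a set set \<Rightarrow> bool" where
  "matching G M \<longleftrightarrow> M \<subseteq> edges G \<and> (\<forall>e\<in>M. \<forall>f\<in>M. e \<noteq> f \<longrightarrow> e \<inter> f = {})"

definition maximum_matching :: "'a ugraph \<Rightarrow> 'a set set \<Rightarrow> bool" where
  "maximum_matching G M \<longleftrightarrow> matching G M \<and> (\<forall>M'. matching G M' \<longrightarrow> card M' \<le> card M)"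

definition matching_number :: "'a ugraph \<Rightarrow> nat" where
  "matching_number G = Max (card ` {M. matching G M})"

text \<open>The notion is only meaningful for \<open>1 \<le> d \<le> \<nu>(G)\<close>; this range is part of the definition.\<close>

definition transversal_set :: "nat \<Rightarrow> 'a ugraph \<Rightarrow> 'a set set \<Rightarrow> bool" where
  "transversal_set d G T \<longleftrightarrow>
     1 \<le> d \<and> d \<le> matching_number G \<and> T \<subseteq> edges G \<and>
     (\<forall>M. maximum_matching G M \<longrightarrow> d \<le> card (T \<inter> M))"

text \<open>For finite graphs and \<open>d\<close> in this range the minimum below is over a nonempty set
  (see \<open>edges_transversal_set\<close>); otherwise the value is unspecified.\<close>

definition transversal_number :: "nat \<Rightarrow> 'a ugraph \<Rightarrow> nat" where
  "transversal_number d G = (LEAST k. \<exists>T. transversal_set d G T \<and> card T = k)"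

definition path_graph :: "nat \<Rightarrow> nat ugraph" where
  "path_graph m = \<lparr>verts = {0..<m}, edges = {{i, i + 1} | i. i + 1 < m}\<rparr>"

text \<open>The cycle is intended for \<open>n \<ge> 3\<close> only.\<close>

definition cycle_graph :: "nat \<Rightarrow> nat ugraph" where
  "cycle_graph n = \<lparr>verts = {0..<n}, edges = {{i, (i + 1) mod n} | i. i < n}\<rparr>"

definition cartesian_product :: "'a ugraph \<Rightarrow> 'b ugraph \<Rightarrow> ('a \<times> 'b) ugraph" (infixl "\<box>" 70) where
  "G \<box> H = \<lparr>verts = verts G \<times> verts H,
     edges = {{(g1, h1), (g2, h2)} | g1 h1 g2 h2.
       g1 \<in> verts G \<and> g2 \<in> verts G \<and> h1 \<in> verts H \<and> h2 \<in> verts H \<and>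
       (g1 = g2 \<and> {h1, h2} \<in> edges H \<or> {g1, g2} \<in> edges G \<and> h1 = h2)}\<rparr>"

lemma simple_graph_path: "simple_graph (path_graph m)"
  by (auto simp: simple_graph_def path_graph_def)

lemma simple_graph_cycle:
  assumes "n \<ge> 3"
  shows "simple_graph (cycle_graph n)"
proof -
  have "i \<noteq> Suc i mod n" if "i < n" for i
    using assms that by (cases "Suc i = n") auto
  then show ?thesis
    using assms by (auto simp: simple_graph_def cycle_graph_def)
qed

lemma simple_graph_cartesian_product:
  assumes "simple_graph G" "simple_graph H"
  shows "simple_graph (G \<box> H)"
proof -
  have "h1 \<noteq> h2" if "{h1, h2} \<in> edges H" for h1 h2
    using assms that by (force simp: simple_graph_def)
  moreover have "g1 \<noteq> g2" if "{g1, g2} \<in> edges G" for g1 g2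
    using assms that by (force simp: simple_graph_def)
  ultimately show ?thesis
    using assms by (auto simp: simple_graph_def cartesian_product_def card_insert_if)
qed

lemma edges_transversal_set:
  assumes G: "simple_graph G" and d: "1 \<le> d" "d \<le> matching_number G"
  shows "transversal_set d G (edges G)"
proof -
  have "edges G \<subseteq> Pow (verts G)" "finite (verts G)"
    using G by (auto simp: simple_graph_def)
  then have "finite (edges G)"
    by (meson finite_Pow_iff finite_subset)
  then have fin: "finite {M. matching G M}"
    by (rule finite_subset[rotated, OF iffD2[OF finite_Pow_iff]]) (auto simp: matching_def)
  have ne: "matching G {}"
    by (simp add: matching_def)
  have "d \<le> card (edges G \<inter> M)" if M: "maximum_matching G M" for M
  proof -
    have "matching_number G \<le> card M"
      unfolding matching_number_def using fin ne M
      by (subst Max_le_iff) (auto simp: maximum_matching_def)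
    moreover have "edges G \<inter> M = M"
      using M by (auto simp: maximum_matching_def matching_def)
    ultimately show ?thesis
      using d by simp
  qed
  then show ?thesis
    using d by (auto simp: transversal_set_def)
qed

end

theory Submission imports Defs begin

text \<open>
  Throughout, \<open>E\<close> is the edge set of the cylinder \<open>P\<^sub>m \<box> C\<^sub>n\<close>, so that
  \<open>|E| = 2mn - n\<close>. Since \<open>m\<close> is even the cylinder has a perfect matching, and a set \<open>T\<close> of edges
  is \<open>d\<close>-transversal iff every perfect matching has at least \<open>d\<close> edges in \<open>T\<close>, equivalently at
  most \<open>k = mn/2 - d\<close> edges outside \<open>T\<close>.

  The upper bounds come from independent sets. A perfect matching covers every vertex exactly once,
  so it contains exactly \<open>|S|\<close> of the edges incident with an independent set \<open>S\<close>. These edges form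
  a \<open>|S|\<close>-transversal, and their complement is an \<open>(mn/2 - |S|)\<close>-transversal. Vertices in the two
  boundary rows have degree 3 and all others have degree 4. Because the cycle is odd, at most
  \<open>n - 1\<close> boundary vertices can be chosen when \<open>m \<ge> 4\<close>. Hence \<open>3d\<close> edges suffice for
  \<open>d \<le> n - 1\<close>. Adding \<open>d - (n - 1)\<close> interior vertices gives \<open>4d - n + 1\<close>. The complement
  for \<open>k\<close> independent interior vertices gives \<open>4d - n\<close>, and is available as long as
  \<open>k \<le> (m - 2)(n - 1)/2\<close>, that is, \<open>d \<ge> n + m/2 - 1\<close>.

  The lower bounds come from averaging over families of perfect matchings which are closed under
  rotation. If every edge lies in at most a third of the matchings of a family, then
  \<open>|T| \<ge> 3d\<close>. If each edge lies in at least \<open>q\<close> of \<open>N\<close> matchings, then \<open>q|E - T| \<le> Nk\<close>. A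
  rotation-closed family treats alike all edges of one row, and all edges between two given rows, so
  only the number of vertical edges between consecutive rows matters. By parity that number is odd
  below rows \<open>0, 2, 4, ...\<close> and even below rows \<open>1, 3, 5, ...\<close>. The matchings \<open>rungs\<close>,
  \<open>one_rung_column\<close> and \<open>one_shifted_column\<close> have the extreme values \<open>(n, 0)\<close>,
  \<open>(1, 0)\<close> and \<open>(1, n - 1)\<close>, and mixing them gives both bounds: see
  \<open>transversal_card_ge_3d\<close> and \<open>transversal_complement_card\<close>. In the second, \<open>q = n - 1\<close> and
  \<open>N = 4(n - 1)\<close> for \<open>n \<ge> 5\<close>, hence \<open>|T| \<ge> 4d - n\<close>. For \<open>n = 3\<close> every perfect matching
  contains one of the three edges between rows 0 and 1, so some of these lie in a third of the
  matchings and not just in a quarter. There \<open>q = 2\<close> and \<open>N = 9\<close>, which produces the second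
  term of the minimum, while the bound \<open>3d\<close> produces the first. For \<open>k = 0\<close> the second bound forces \<open>T = E\<close>.
\<close>

section \<open>Perfect matchings and transversals of finite graphs\<close>

definition perfect_matching :: "'a ugraph \<Rightarrow> 'a set set \<Rightarrow> bool" where
  "perfect_matching G M \<longleftrightarrow> M \<subseteq> edges G \<and> (\<forall>v\<in>verts G. card {e \<in> M. v \<in> e} = 1)"

lemma finite_edges:
  assumes "simple_graph G"
  shows "finite (edges G)"
proof -
  have "edges G \<subseteq> Pow (verts G)" "finite (verts G)"
    using assms by (auto simp: simple_graph_def)
  then show ?thesis
    by (meson finite_Pow_iff finite_subset)
qed

lemma sum_degrees:
  assumes G: "simple_graph G" and A: "A \<subseteq> edges G"
  shows "(\<Sum>v\<in>verts G. card {e \<in> A. v \<in> e}) = 2 * card A"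
proof (rule sum_multicount)
  show "finite (verts G)"
    using G by (simp add: simple_graph_def)
  show "finite A"
    using A finite_edges[OF G] by (rule finite_subset)
  show "\<forall>e\<in>A. card {v \<in> verts G. v \<in> e} = 2"
  proof
    fix e assume "e \<in> A"
    then have "e \<subseteq> verts G" "card e = 2"
      using G A by (auto simp: simple_graph_def)
    moreover from this have "{v \<in> verts G. v \<in> e} = e"
      by blast
    ultimately show "card {v \<in> verts G. v \<in> e} = 2"
      by simp
  qed
qed

lemma matching_degree_le_1:
  assumes "simple_graph G" "matching G M"
  shows "card {e \<in> M. v \<in> e} \<le> 1"
proof -
  have "finite M"
    using assms finite_edges finite_subset by (auto simp: matching_def)
  moreover have "e = f" if "e \<in> M" "f \<in> M" "v \<in> e" "v \<in> f" for e f
    using assms(2) that unfolding matching_def by blast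
  ultimately show ?thesis
    by (auto simp: card_le_Suc0_iff_eq)
qed

lemma card_perfect_matching:
  assumes "simple_graph G" "perfect_matching G M"
  shows "2 * card M = card (verts G)"
  using sum_degrees[OF assms(1), of M] assms(2) by (simp add: perfect_matching_def)

lemma perfect_matching_imp_matching:
  assumes G: "simple_graph G" and M: "perfect_matching G M"
  shows "matching G M"
  unfolding matching_def
proof (intro conjI ballI impI)
  show "M \<subseteq> edges G"
    using M by (simp add: perfect_matching_def)
  fix e f assume ef: "e \<in> M" "f \<in> M" "e \<noteq> f"
  show "e \<inter> f = {}"
  proof (rule ccontr)
    assume "e \<inter> f \<noteq> {}"
    then obtain v where v: "v \<in> e" "v \<in> f" by blast
    then have "v \<in> verts G"
      using ef M G by (auto simp: perfect_matching_def simple_graph_def)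
    then obtain g where "{e \<in> M. v \<in> e} = {g}"
      using M by (auto simp: perfect_matching_def card_1_singleton_iff)
    moreover have "e \<in> {e \<in> M. v \<in> e}" "f \<in> {e \<in> M. v \<in> e}"
      using ef v by auto
    ultimately show False
      using ef(3) by simp
  qed
qed

lemma matching_card_le:
  assumes "simple_graph G" "matching G M"
  shows "2 * card M \<le> card (verts G)"
proof -
  have "2 * card M = (\<Sum>v\<in>verts G. card {e \<in> M. v \<in> e})"
    using assms by (simp add: sum_degrees matching_def)
  also have "\<dots> \<le> (\<Sum>v\<in>verts G. 1)"
    using matching_degree_le_1[OF assms] by (intro sum_mono) auto
  finally show ?thesis by simp
qed

text \<open>Summing the degrees in \<open>M\<close> gives twice its size, and every degree is at most 1; the sum is
  as large as for the perfect matching \<open>M0\<close> only if all degrees are 1.\<close>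

lemma maximum_matching_iff_perfect:
  assumes G: "simple_graph G" and M0: "perfect_matching G M0"
  shows "maximum_matching G M \<longleftrightarrow> perfect_matching G M"
proof
  assume max: "maximum_matching G M"
  then have M: "matching G M" and "card M0 \<le> card M"
    using perfect_matching_imp_matching[OF G M0] by (auto simp: maximum_matching_def)
  then have "card (verts G) \<le> 2 * card M"
    using card_perfect_matching[OF G M0] by simp
  then have sum: "(\<Sum>v\<in>verts G. 1) \<le> (\<Sum>v\<in>verts G. card {e \<in> M. v \<in> e})"
    using M G by (simp add: sum_degrees matching_def)
  have fin: "finite (verts G)"
    using G by (simp add: simple_graph_def)
  have "card {e \<in> M. v \<in> e} = 1" if v: "v \<in> verts G" for v
  proof (rule ccontr)
    assume "card {e \<in> M. v \<in> e} \<noteq> 1"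
    then have "card {e \<in> M. v \<in> e} < 1"
      using matching_degree_le_1[OF G M, of v] by simp
    then have "(\<Sum>v\<in>verts G. card {e \<in> M. v \<in> e}) < (\<Sum>v\<in>verts G. 1)"
      using v fin matching_degree_le_1[OF G M] by (intro sum_strict_mono_ex1) auto
    then show False using sum by simp
  qed
  then show "perfect_matching G M"
    using M by (simp add: perfect_matching_def matching_def)
next
  assume "perfect_matching G M"
  then show "maximum_matching G M"
    using matching_card_le[OF G] card_perfect_matching[OF G] perfect_matching_imp_matching[OF G]
    by (fastforce simp: maximum_matching_def)
qed

lemma matching_number_perfect:
  assumes G: "simple_graph G" and M: "perfect_matching G M"
  shows "matching_number G = card M"
  unfolding matching_number_def
proof (rule Max_eqI)
  have "{M. matching G M} \<subseteq> Pow (edges G)"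
    by (auto simp: matching_def)
  then show "finite (card ` {M. matching G M})"
    using finite_edges[OF G] by (meson finite_Pow_iff finite_imageI finite_subset)
  show "card M \<in> card ` {M. matching G M}"
    using perfect_matching_imp_matching[OF G M] by blast
  show "\<And>k. k \<in> card ` {M. matching G M} \<Longrightarrow> k \<le> card M"
    using M maximum_matching_iff_perfect[OF G M, of M] by (auto simp: maximum_matching_def)
qed

lemma transversal_number_le:
  assumes "transversal_set d G T"
  shows "transversal_number d G \<le> card T"
  unfolding transversal_number_def by (rule Least_le) (use assms in blast)

lemma transversal_number_attained:
  assumes "simple_graph G" "1 \<le> d" "d \<le> matching_number G"
  obtains T where "transversal_set d G T" "card T = transversal_number d G"
proof -
  have "\<exists>k T. transversal_set d G T \<and> card T = k"
    using edges_transversal_set[OF assms] by blast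
  then have "\<exists>T. transversal_set d G T \<and> card T = transversal_number d G"
    unfolding transversal_number_def by (rule LeastI_ex)
  then show ?thesis
    using that by (elim exE conjE)
qed

text \<open>An edge has two endpoints, so it lies inside \<open>S\<close> exactly when it joins two vertices of \<open>S\<close>.\<close>

definition independent_set :: "'a ugraph \<Rightarrow> 'a set \<Rightarrow> bool" where
  "independent_set G S \<longleftrightarrow> S \<subseteq> verts G \<and> (\<forall>e\<in>edges G. \<not> e \<subseteq> S)"

definition incident_edges :: "'a ugraph \<Rightarrow> 'a set \<Rightarrow> 'a set set" where
  "incident_edges G S = {e \<in> edges G. e \<inter> S \<noteq> {}}"

lemma independent_set_mono: "independent_set G S \<Longrightarrow> S' \<subseteq> S \<Longrightarrow> independent_set G S'"
  unfolding independent_set_def by blast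

text \<open>Each incident edge has exactly one endpoint in the independent set, so counting by endpoints is
  exact. It is used with a perfect matching for \<open>A\<close>, where all summands are 1, and with all edges
  for \<open>A\<close>, where the summands are the degrees.\<close>

lemma card_incident_edges_Int:
  assumes G: "simple_graph G" and S: "independent_set G S" and A: "A \<subseteq> edges G"
  shows "card (incident_edges G S \<inter> A) = (\<Sum>v\<in>S. card {e \<in> A. v \<in> e})"
proof -
  let ?I = "incident_edges G S \<inter> A"
  have fin: "finite S" "finite ?I"
    using G S finite_edges[OF G]
    by (auto simp: simple_graph_def independent_set_def incident_edges_def intro: finite_subset)
  have "card {v \<in> S. v \<in> e} = 1" if "e \<in> ?I" for e
  proof -
    have e: "e \<in> edges G" "card e = 2" "e \<inter> S \<noteq> {}" "\<not> e \<subseteq> S"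
      using that G S by (auto simp: incident_edges_def simple_graph_def independent_set_def)
    then obtain u w where "e = {u, w}" "u \<noteq> w"
      by (auto simp: card_2_iff)
    then have "{v \<in> S. v \<in> e} = {u} \<or> {v \<in> S. v \<in> e} = {w}"
      using e by auto
    then show ?thesis by auto
  qed
  then have "(\<Sum>v\<in>S. card {e \<in> ?I. v \<in> e}) = 1 * card ?I"
    using fin by (intro sum_multicount) auto
  moreover have "{e \<in> ?I. v \<in> e} = {e \<in> A. v \<in> e}" if "v \<in> S" for v
    using that A by (auto simp: incident_edges_def)
  ultimately show ?thesis by simp
qed

lemma card_incident_edges_perfect_matching:
  assumes "simple_graph G" "independent_set G S" "perfect_matching G M"
  shows "card (incident_edges G S \<inter> M) = card S"
proof -
  have "card {e \<in> M. v \<in> e} = 1" if "v \<in> S" for v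
    using assms that by (auto simp: perfect_matching_def independent_set_def)
  then show ?thesis
    using assms by (simp add: card_incident_edges_Int perfect_matching_def)
qed

lemma transversal_incident_edges:
  assumes G: "simple_graph G" and M0: "perfect_matching G M0"
    and S: "independent_set G S" "S \<noteq> {}"
  shows "transversal_set (card S) G (incident_edges G S)"
proof -
  have "finite S"
    using G S by (auto simp: simple_graph_def independent_set_def intro: finite_subset)
  moreover have "card S \<le> card M0"
    using card_incident_edges_perfect_matching[OF G S(1) M0]
      finite_edges[OF G] M0
    by (metis Int_lower2 card_mono perfect_matching_def finite_subset)
  ultimately show ?thesis
    using S card_incident_edges_perfect_matching[OF G S(1)]
    by (auto simp: transversal_set_def matching_number_perfect[OF G M0]
        maximum_matching_iff_perfect[OF G M0] incident_edges_def card_gt_0_iff Suc_le_eq)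
qed

lemma transversal_non_incident_edges:
  assumes G: "simple_graph G" and M0: "perfect_matching G M0"
    and S: "independent_set G S" and d: "d + card S = card M0" "1 \<le> d"
  shows "transversal_set d G (edges G - incident_edges G S)"
proof -
  have "d \<le> card ((edges G - incident_edges G S) \<inter> M)" if M: "perfect_matching G M" for M
  proof -
    have sub: "M \<subseteq> edges G"
      using M by (simp add: perfect_matching_def)
    then have "finite M"
      using finite_edges[OF G] by (rule finite_subset)
    then have "card (M - (incident_edges G S \<inter> M)) = card M - card S"
      using card_incident_edges_perfect_matching[OF G S M] by (subst card_Diff_subset) auto
    moreover have "(edges G - incident_edges G S) \<inter> M = M - (incident_edges G S \<inter> M)"
      using sub by blast
    moreover have "card M = card M0"
      using card_perfect_matching[OF G M] card_perfect_matching[OF G M0] by simp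
    ultimately show ?thesis
      using d by simp
  qed
  then show ?thesis
    using d by (auto simp: transversal_set_def matching_number_perfect[OF G M0]
        maximum_matching_iff_perfect[OF G M0])
qed

text \<open>The double counting behind the averaging arguments: the right-hand side counts each edge of
  \<open>X\<close> with its multiplicity in the family \<open>\<M>\<close>.\<close>

lemma sum_card_Int:
  assumes "finite X" "finite I"
  shows "(\<Sum>i\<in>I. card (X \<inter> \<M> i)) = (\<Sum>e\<in>X. card {i \<in> I. e \<in> \<M> i})"
proof -
  have "(\<Sum>i\<in>I. card {e \<in> X. e \<in> \<M> i}) = (\<Sum>e\<in>X. card {i \<in> I. e \<in> \<M> i})"
    using assms by (intro sum_multicount_gen) auto
  then show ?thesis
    by (simp add: Int_def)
qed

section \<open>The cylinder over an odd cycle with an even number of rows\<close>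

locale odd_cylinder =
  fixes m n :: nat
  assumes even_m: "even m" and m_ge: "m \<ge> 2" and odd_n: "odd n" and n_ge: "n \<ge> 3"
begin

definition cylinder :: "(nat \<times> nat) ugraph" where
  "cylinder = path_graph m \<box> cycle_graph n"

definition horizontal :: "nat \<Rightarrow> nat \<Rightarrow> (nat \<times> nat) set" where
  "horizontal i j = {(i, j), (i, Suc j mod n)}"

definition vertical :: "nat \<Rightarrow> nat \<Rightarrow> (nat \<times> nat) set" where
  "vertical i j = {(i, j), (Suc i, j)}"

text \<open>Every set of edges can be described by a condition on the horizontal and one on the vertical
  edges. Degrees in such a set are sums of four truth values, so being a perfect matching becomes a
  case distinction on rows and columns.\<close>

definition edges_where ::
  "(nat \<Rightarrow> nat \<Rightarrow> bool) \<Rightarrow> (nat \<Rightarrow> nat \<Rightarrow> bool) \<Rightarrow> (nat \<times> nat) set set" where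
  "edges_where P Q =
     {horizontal i j | i j. i < m \<and> j < n \<and> P i j} \<union> {vertical i j | i j. Suc i < m \<and> j < n \<and> Q i j}"

definition left :: "nat \<Rightarrow> nat" where
  "left j = (if j = 0 then n - 1 else j - 1)"

lemma Suc_mod_n: "j < n \<Longrightarrow> Suc j mod n = (if j = n - 1 then 0 else Suc j)"
  using n_ge by auto

lemma left_less: "j < n \<Longrightarrow> left j < n"
  by (auto simp: left_def)

lemma Suc_mod_eq_iff_left: "j < n \<Longrightarrow> j' < n \<Longrightarrow> j = Suc j' mod n \<longleftrightarrow> j' = left j"
  using n_ge by (auto simp: Suc_mod_n left_def)

lemma simple_graph_cylinder: "simple_graph cylinder"
  unfolding cylinder_def
  by (intro simple_graph_cartesian_product simple_graph_path simple_graph_cycle n_ge)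

lemma verts_cylinder: "verts cylinder = {..<m} \<times> {..<n}"
  by (auto simp: cylinder_def cartesian_product_def path_graph_def cycle_graph_def)

lemma edges_cylinder: "edges cylinder = edges_where (\<lambda>_ _. True) (\<lambda>_ _. True)"
proof (intro set_eqI iffI)
  fix e assume "e \<in> edges cylinder"
  then have "\<exists>g1 h1 g2 h2. e = {(g1, h1), (g2, h2)} \<and> g1 < m \<and> g2 < m \<and> h1 < n \<and> h2 < n \<and>
      (g1 = g2 \<and> (\<exists>j. {h1, h2} = {j, Suc j mod n} \<and> j < n) \<or>
       (\<exists>i. {g1, g2} = {i, Suc i} \<and> Suc i < m) \<and> h1 = h2)"
    by (simp add: cylinder_def cartesian_product_def path_graph_def cycle_graph_def)
  then obtain g1 h1 g2 h2 where e: "e = {(g1, h1), (g2, h2)}"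
    and lt: "g1 < m" "g2 < m" "h1 < n" "h2 < n"
    and adj: "g1 = g2 \<and> (\<exists>j. {h1, h2} = {j, Suc j mod n} \<and> j < n) \<or>
         (\<exists>i. {g1, g2} = {i, Suc i} \<and> Suc i < m) \<and> h1 = h2"
    by (elim exE conjE)
  show "e \<in> edges_where (\<lambda>_ _. True) (\<lambda>_ _. True)"
    using adj
  proof (elim disjE exE conjE)
    fix j assume "g1 = g2" "j < n" "{h1, h2} = {j, Suc j mod n}"
    then have "e = horizontal g1 j"
      using e by (auto simp: horizontal_def doubleton_eq_iff)
    then show ?thesis
      using lt \<open>j < n\<close> by (auto simp: edges_where_def)
  next
    fix i assume "{g1, g2} = {i, Suc i}" "Suc i < m" "h1 = h2"
    then have "e = vertical i h1"
      using e by (auto simp: vertical_def doubleton_eq_iff)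
    then show ?thesis
      using lt \<open>Suc i < m\<close> by (auto simp: edges_where_def)
  qed
next
  fix e assume "e \<in> edges_where (\<lambda>_ _. True) (\<lambda>_ _. True)"
  then consider i j where "i < m" "j < n" "e = horizontal i j"
    | i j where "Suc i < m" "j < n" "e = vertical i j"
    by (auto simp: edges_where_def)
  then show "e \<in> edges cylinder"
  proof cases
    case 1
    then have "{j, Suc j mod n} \<in> edges (cycle_graph n)" "Suc j mod n < n"
      by (auto simp: cycle_graph_def)
    moreover have "verts (path_graph m) = {0..<m}" "verts (cycle_graph n) = {0..<n}"
      by (auto simp: path_graph_def cycle_graph_def)
    ultimately show ?thesis
      using 1 unfolding cylinder_def cartesian_product_def horizontal_def ugraph.simps mem_Collect_eq
      by (intro exI[of _ i] exI[of _ j] exI[of _ "Suc j mod n"]) simp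
  next
    case 2
    then have "{i, Suc i} \<in> edges (path_graph m)"
      by (auto simp: path_graph_def)
    moreover have "verts (path_graph m) = {0..<m}" "verts (cycle_graph n) = {0..<n}"
      by (auto simp: path_graph_def cycle_graph_def)
    ultimately show ?thesis
      using 2 unfolding cylinder_def cartesian_product_def vertical_def ugraph.simps mem_Collect_eq
      by (intro exI[of _ i] exI[of _ j] exI[of _ "Suc i"]) simp
  qed
qed

lemma horizontal_eq_iff:
  assumes "j < n" "j' < n"
  shows "horizontal i j = horizontal i' j' \<longleftrightarrow> i = i' \<and> j = j'"
  using assms n_ge by (auto simp: horizontal_def doubleton_eq_iff Suc_mod_n split: if_splits)

lemma vertical_eq_iff: "vertical i j = vertical i' j' \<longleftrightarrow> i = i' \<and> j = j'"
  by (auto simp: vertical_def doubleton_eq_iff)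

lemma horizontal_neq_vertical: "horizontal i j \<noteq> vertical i' j'"
  by (auto simp: vertical_def horizontal_def doubleton_eq_iff)

lemma horizontal_in_edges_where:
  "i < m \<Longrightarrow> j < n \<Longrightarrow> horizontal i j \<in> edges_where P Q \<longleftrightarrow> P i j"
  using horizontal_neq_vertical by (auto simp: edges_where_def horizontal_eq_iff)

lemma vertical_in_edges_where:
  "Suc i < m \<Longrightarrow> j < n \<Longrightarrow> vertical i j \<in> edges_where P Q \<longleftrightarrow> Q i j"
  using horizontal_neq_vertical by (auto simp: edges_where_def vertical_eq_iff) metis

lemma edges_where_subset: "edges_where P Q \<subseteq> edges cylinder"
  by (auto simp: edges_cylinder edges_where_def)

lemma cylinder_edge_cases:
  assumes "e \<in> edges cylinder"
  obtains i j where "i < m" "j < n" "e = horizontal i j"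
    | i j where "Suc i < m" "j < n" "e = vertical i j"
  using assms by (auto simp: edges_cylinder edges_where_def)

lemma degree_edges_where:
  assumes ij: "i < m" "j < n"
  shows "card {e \<in> edges_where P Q. (i, j) \<in> e} =
    of_bool (P i j) + of_bool (P i (left j)) + of_bool (Suc i < m \<and> Q i j) + of_bool (0 < i \<and> Q (i - 1) j)"
proof -
  have "{e \<in> edges_where P Q. (i, j) \<in> e} =
      (if P i j then {horizontal i j} else {}) \<union>
      (if P i (left j) then {horizontal i (left j)} else {}) \<union>
      (if Suc i < m \<and> Q i j then {vertical i j} else {}) \<union>
      (if 0 < i \<and> Q (i - 1) j then {vertical (i - 1) j} else {})" (is "?L = ?R")
  proof (intro set_eqI iffI)
    fix e assume "e \<in> ?L"
    then have e: "e \<in> edges cylinder" and mem: "(i, j) \<in> e" "e \<in> edges_where P Q"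
      using edges_where_subset by auto
    show "e \<in> ?R"
      using e
    proof (cases rule: cylinder_edge_cases)
      case (1 i' j')
      then have "P i' j'"
        using mem by (simp add: horizontal_in_edges_where)
      moreover have "i' = i \<and> (j' = j \<or> j' = left j)"
        using 1 mem ij Suc_mod_eq_iff_left by (auto simp: horizontal_def)
      ultimately show ?thesis using 1 by auto
    next
      case (2 i' j')
      then have "Q i' j'"
        using mem by (simp add: vertical_in_edges_where)
      moreover have "j' = j \<and> (i' = i \<or> Suc i' = i)"
        using 2 mem by (auto simp: vertical_def)
      ultimately show ?thesis using 2 by auto
    qed
  next
    fix e assume "e \<in> ?R"
    moreover have "(i, j) \<in> horizontal i (left j)"
      using Suc_mod_eq_iff_left[OF ij(2) left_less[OF ij(2)]] by (simp add: horizontal_def)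
    ultimately show "e \<in> ?L"
      using ij left_less[OF ij(2)]
      by (auto simp: horizontal_in_edges_where vertical_in_edges_where split: if_splits)
        (auto simp: horizontal_def vertical_def)
  qed
  moreover have "left j \<noteq> j" "left j < n"
    using ij n_ge by (auto simp: left_def)
  ultimately show ?thesis
    using ij
    by (cases i) (simp_all add: horizontal_eq_iff vertical_eq_iff horizontal_neq_vertical
        horizontal_neq_vertical[symmetric] card_insert_if)
qed

lemma degree_cylinder:
  assumes "i < m" "j < n"
  shows "card {e \<in> edges cylinder. (i, j) \<in> e} = (if i = 0 \<or> i = m - 1 then 3 else 4)"
  using assms m_ge by (auto simp: edges_cylinder degree_edges_where)

lemma card_edges_cylinder: "card (edges cylinder) + n = 2 * m * n"
proof -
  have "2 * card (edges cylinder) = (\<Sum>i<m. \<Sum>j<n. card {e \<in> edges cylinder. (i, j) \<in> e})"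
    using sum_degrees[OF simple_graph_cylinder order_refl]
    by (simp add: verts_cylinder sum.cartesian_product case_prod_unfold)
  also have "\<dots> = (\<Sum>i<m. n * (if i = 0 \<or> i = m - 1 then 3 else 4))"
    by (simp add: degree_cylinder)
  finally have "2 * card (edges cylinder) + (\<Sum>i<m. n * (if i = 0 \<or> i = m - 1 then 1 else 0))
      = (\<Sum>i<m. 4 * n)"
    by (simp only: flip: sum.distrib) (rule sum.cong, auto)
  moreover have "(\<Sum>i<m. n * (if i = 0 \<or> i = m - 1 then 1 else 0)) = (\<Sum>i\<in>{0, m - 1}. n)"
    using m_ge by (intro sum.mono_neutral_cong_right) auto
  ultimately show ?thesis
    using m_ge by simp
qed

lemma int_card_edges_cylinder: "int (card (edges cylinder)) + int n = 2 * int m * int n"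
  using card_edges_cylinder by (metis of_nat_add of_nat_mult of_nat_numeral)

lemma perfect_matchingI:
  assumes "\<And>i j. i < m \<Longrightarrow> j < n \<Longrightarrow>
    of_bool (P i j) + of_bool (P i (left j)) + of_bool (Suc i < m \<and> Q i j)
      + of_bool (0 < i \<and> Q (i - 1) j) = (1 :: nat)"
  shows "perfect_matching cylinder (edges_where P Q)"
  using assms by (auto simp: perfect_matching_def edges_where_subset verts_cylinder degree_edges_where)

section \<open>Three kinds of perfect matchings\<close>

text \<open>The number of steps to the right, around the cycle, from column \<open>r\<close> to column \<open>j\<close>. Removing
  column \<open>r\<close> leaves a path on the even number \<open>n - 1\<close> of columns with offsets \<open>1, ..., n - 1\<close>. The
  perfect matching of this path consists of the edges that start at an odd offset.\<close>

definition offset :: "nat \<Rightarrow> nat \<Rightarrow> nat" where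
  "offset r j = (if r \<le> j then j - r else j + n - r)"

definition rungs :: "(nat \<times> nat) set set" where
  "rungs = edges_where (\<lambda>_ _. False) (\<lambda>i _. even i)"

text \<open>Column \<open>r\<close> is matched vertically, and every row is matched horizontally in the other columns.\<close>

definition one_rung_column :: "nat \<Rightarrow> (nat \<times> nat) set set" where
  "one_rung_column r = edges_where (\<lambda>_ j. odd (offset r j)) (\<lambda>i j. even i \<and> j = r)"

text \<open>Column \<open>r\<close> is matched by its edges between rows \<open>0, 1\<close>, rows \<open>2, 3\<close> and so on. All other columns are
  matched by the edges between rows \<open>1, 2\<close>, rows \<open>3, 4\<close> and so on, which leaves their vertices in
  the first and the last row to be matched horizontally.\<close>

definition one_shifted_column :: "nat \<Rightarrow> (nat \<times> nat) set set" where
  "one_shifted_column r =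
     edges_where (\<lambda>i j. (i = 0 \<or> i = m - 1) \<and> odd (offset r j)) (\<lambda>i j. even i \<longleftrightarrow> j = r)"

lemma odd_offset_left:
  assumes "r < n" "j < n"
  shows "odd (offset r (left j)) \<longleftrightarrow> even (offset r j) \<and> j \<noteq> r"
  using assms odd_n by (cases "r = j") (auto simp: offset_def left_def)

lemma even_imp_Suc_less: "i < m \<Longrightarrow> even i \<Longrightarrow> Suc i < m"
  using even_m by (metis Suc_lessI even_Suc)

lemma perfect_rungs: "perfect_matching cylinder rungs"
  unfolding rungs_def
proof (rule perfect_matchingI)
  fix i j assume "i < m" "j < n"
  then show "of_bool False + of_bool False + of_bool (Suc i < m \<and> even i)
      + of_bool (0 < i \<and> even (i - 1)) = (1 :: nat)"
    using even_imp_Suc_less by (cases i) auto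
qed

lemma perfect_one_rung_column:
  assumes "r < n"
  shows "perfect_matching cylinder (one_rung_column r)"
  unfolding one_rung_column_def
proof (rule perfect_matchingI)
  fix i j assume ij: "i < m" "j < n"
  have "even (offset r r)"
    by (simp add: offset_def)
  then show "of_bool (odd (offset r j)) + of_bool (odd (offset r (left j)))
      + of_bool (Suc i < m \<and> even i \<and> j = r) + of_bool (0 < i \<and> even (i - 1) \<and> j = r) = (1 :: nat)"
    using even_imp_Suc_less[OF ij(1)] odd_offset_left[OF assms ij(2)] by (cases i) auto
qed

lemma perfect_one_shifted_column:
  assumes "r < n"
  shows "perfect_matching cylinder (one_shifted_column r)"
  unfolding one_shifted_column_def
proof (rule perfect_matchingI)
  fix i j assume ij: "i < m" "j < n"
  have "even (offset r r)"
    by (simp add: offset_def)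
  moreover have "Suc i < m \<longleftrightarrow> i \<noteq> m - 1"
    using ij by auto
  moreover have "odd (m - 1)"
    using even_m m_ge by simp
  ultimately show "of_bool ((i = 0 \<or> i = m - 1) \<and> odd (offset r j))
      + of_bool ((i = 0 \<or> i = m - 1) \<and> odd (offset r (left j)))
      + of_bool (Suc i < m \<and> (even i \<longleftrightarrow> j = r)) + of_bool (0 < i \<and> (even (i - 1) \<longleftrightarrow> j = r)) = (1 :: nat)"
    using odd_offset_left[OF assms ij(2)] by (cases "i = m - 1"; cases i; cases "j = r") auto
qed

text \<open>For fixed \<open>j\<close>, the map from \<open>r\<close> to the offset is an involution of the columns, so this
  counts the odd numbers below the odd number \<open>n\<close>.\<close>

lemma card_odd_offset:
  assumes "j < n"
  shows "2 * card {r. r < n \<and> odd (offset r j)} = n - 1"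
proof -
  have "bij_betw (\<lambda>r. offset r j) {r. r < n \<and> odd (offset r j)} {s. s < n \<and> odd s}"
    using assms by (intro bij_betw_byWitness[where f' = "\<lambda>s. offset s j"]) (auto simp: offset_def)
  then have "card {r. r < n \<and> odd (offset r j)} = card {s. s < n \<and> odd s}"
    by (rule bij_betw_same_card)
  moreover have "{s. s < n \<and> odd s} = (\<lambda>t. Suc (2 * t)) ` {..<(n - 1) div 2}"
    using odd_n by (auto elim!: oddE)
  moreover have "card ((\<lambda>t. Suc (2 * t)) ` {..<(n - 1) div 2}) = (n - 1) div 2"
    by (simp add: card_image inj_on_def)
  ultimately show ?thesis
    using odd_n by simp
qed

lemma card_neq_column: "j < n \<Longrightarrow> card {r. r < n \<and> r \<noteq> j} = n - 1"
proof -
  assume "j < n"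
  moreover have "{r. r < n \<and> r \<noteq> j} = {..<n} - {j}"
    by auto
  ultimately show ?thesis
    by simp
qed

lemma card_matching_number: "card rungs = m * n div 2" "matching_number cylinder = m * n div 2"
  using card_perfect_matching[OF simple_graph_cylinder perfect_rungs]
    matching_number_perfect[OF simple_graph_cylinder perfect_rungs]
  by (auto simp: verts_cylinder)

section \<open>Lower bounds by averaging over rotations\<close>

lemma sum_matching_multiplicities:
  assumes "X \<subseteq> edges cylinder"
  shows "(\<Sum>e\<in>X. a * card {r. r < n \<and> e \<in> one_rung_column r} + c * card {r. r < n \<and> e \<in> one_shifted_column r}
        + b * of_bool (e \<in> rungs)) =
      a * (\<Sum>r<n. card (X \<inter> one_rung_column r)) + c * (\<Sum>r<n. card (X \<inter> one_shifted_column r))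
        + b * card (X \<inter> rungs)"
proof -
  have X: "finite X"
    using assms finite_edges[OF simple_graph_cylinder] by (rule finite_subset)
  have "card (X \<inter> rungs) = (\<Sum>e\<in>X. of_bool (e \<in> rungs))"
    using X by (simp add: Int_def)
  then show ?thesis
    using X by (simp add: sum_card_Int sum.distrib sum_distrib_left)
qed

lemma multiplicity_horizontal:
  assumes "i < m" "j < n"
  shows "2 * card {r. r < n \<and> horizontal i j \<in> one_rung_column r} = n - 1"
    "horizontal i j \<notin> rungs"
  using assms card_odd_offset[OF assms(2)]
  by (auto simp: one_rung_column_def rungs_def horizontal_in_edges_where)

lemma multiplicity_vertical:
  assumes "Suc i < m" "j < n"
  shows "card {r. r < n \<and> vertical i j \<in> one_rung_column r} = of_bool (even i)"
    "card {r. r < n \<and> vertical i j \<in> one_shifted_column r} = (if even i then 1 else n - 1)"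
    "vertical i j \<in> rungs \<longleftrightarrow> even i"
proof -
  have "{r. r < n \<and> j = r} = {j}"
    using assms by auto
  then show "card {r. r < n \<and> vertical i j \<in> one_rung_column r} = of_bool (even i)"
    "card {r. r < n \<and> vertical i j \<in> one_shifted_column r} = (if even i then 1 else n - 1)"
    "vertical i j \<in> rungs \<longleftrightarrow> even i"
    using assms card_neq_column[OF assms(2)]
    by (auto simp: one_rung_column_def one_shifted_column_def rungs_def vertical_in_edges_where
        eq_commute[of _ j])
qed

lemma transversal_card_Int:
  assumes "transversal_set d cylinder T" "perfect_matching cylinder M"
  shows "d \<le> card (T \<inter> M)"
  using assms maximum_matching_iff_perfect[OF simple_graph_cylinder perfect_rungs]
  by (auto simp: transversal_set_def)

text \<open>Take each rotation of \<open>one_rung_column\<close> twice and \<open>rungs\<close> \<open>n - 3\<close> times, which makes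
  \<open>3(n - 1)\<close> matchings. A horizontal edge lies in \<open>n - 1\<close> of them, a vertical edge in
  \<open>2 + (n - 3)\<close> or in none.\<close>

lemma transversal_card_ge_3d:
  assumes T: "transversal_set d cylinder T"
  shows "3 * d \<le> card T"
proof -
  have sub: "T \<subseteq> edges cylinder"
    using T by (simp add: transversal_set_def)
  have "(2 * n + (n - 3)) * d = 2 * (\<Sum>r<n. d) + 0 * (\<Sum>r<n. card (T \<inter> one_shifted_column r)) + (n - 3) * d"
    by (simp add: algebra_simps)
  also have "\<dots> \<le> 2 * (\<Sum>r<n. card (T \<inter> one_rung_column r))
      + 0 * (\<Sum>r<n. card (T \<inter> one_shifted_column r)) + (n - 3) * card (T \<inter> rungs)"
    using transversal_card_Int[OF T] perfect_rungs perfect_one_rung_column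
    by (intro add_mono mult_left_mono sum_mono) auto
  also have "\<dots> = (\<Sum>e\<in>T. 2 * card {r. r < n \<and> e \<in> one_rung_column r}
      + 0 * card {r. r < n \<and> e \<in> one_shifted_column r} + (n - 3) * of_bool (e \<in> rungs))"
    by (rule sum_matching_multiplicities[OF sub, symmetric])
  also have "\<dots> \<le> (\<Sum>e\<in>T. n - 1)"
  proof (rule sum_mono)
    fix e assume "e \<in> T"
    then have "e \<in> edges cylinder"
      using sub by blast
    then show "2 * card {r. r < n \<and> e \<in> one_rung_column r}
      + 0 * card {r. r < n \<and> e \<in> one_shifted_column r} + (n - 3) * of_bool (e \<in> rungs) \<le> n - 1"
      using n_ge by (cases rule: cylinder_edge_cases)
        (auto simp: multiplicity_horizontal multiplicity_vertical)
  qed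
  finally have "(2 * n + (n - 3)) * d \<le> (n - 1) * card T"
    by (simp add: mult.commute)
  moreover have "2 * n + (n - 3) = (n - 1) * 3"
    using n_ge by simp
  ultimately have "(n - 1) * (3 * d) \<le> (n - 1) * card T"
    by (metis mult.assoc)
  then show ?thesis
    using n_ge by simp
qed

text \<open>Take each rotation of \<open>one_rung_column\<close> twice, each rotation of \<open>one_shifted_column\<close> once
  and \<open>rungs\<close> \<open>n - 4\<close> times. Horizontal edges are covered \<open>n - 1\<close> times already by the first
  kind. Vertical edges below odd rows are covered \<open>n - 1\<close> times by the second kind. Vertical edges
  below even rows are covered \<open>2 + 1 + (n - 4)\<close> times. The truncated difference is intended: for
  \<open>n = 3\<close> it is 0, and the latter edges are covered \<open>3 > n - 1\<close> times.\<close>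

lemma transversal_complement_card:
  assumes T: "transversal_set d cylinder T"
  shows "(n - 1) * card (edges cylinder - T) \<le> (3 * n + (n - 4)) * (m * n div 2 - d)"
proof -
  let ?F = "edges cylinder - T" and ?k = "m * n div 2 - d"
  have le: "card (?F \<inter> M) \<le> ?k" if M: "perfect_matching cylinder M" for M
  proof -
    have sub: "M \<subseteq> edges cylinder"
      using M by (simp add: perfect_matching_def)
    then have "finite M"
      using finite_edges[OF simple_graph_cylinder] by (rule finite_subset)
    then have "card (M - (T \<inter> M)) = card M - card (T \<inter> M)"
      by (subst card_Diff_subset) auto
    moreover have "?F \<inter> M = M - (T \<inter> M)"
      using sub by blast
    moreover have "card M = m * n div 2"
      using card_perfect_matching[OF simple_graph_cylinder M] by (simp add: verts_cylinder)
    ultimately show ?thesis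
      using transversal_card_Int[OF T M] by simp
  qed
  have "(n - 1) * card ?F = (\<Sum>e\<in>?F. n - 1)"
    by (simp add: mult.commute)
  also have "\<dots> \<le> (\<Sum>e\<in>?F. 2 * card {r. r < n \<and> e \<in> one_rung_column r}
      + 1 * card {r. r < n \<and> e \<in> one_shifted_column r} + (n - 4) * of_bool (e \<in> rungs))"
  proof (rule sum_mono)
    fix e assume "e \<in> ?F"
    then have "e \<in> edges cylinder"
      by blast
    then show "n - 1 \<le> 2 * card {r. r < n \<and> e \<in> one_rung_column r}
      + 1 * card {r. r < n \<and> e \<in> one_shifted_column r} + (n - 4) * of_bool (e \<in> rungs)"
      using n_ge by (cases rule: cylinder_edge_cases)
        (auto simp: multiplicity_horizontal multiplicity_vertical)
  qed
  also have "\<dots> = 2 * (\<Sum>r<n. card (?F \<inter> one_rung_column r))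
      + 1 * (\<Sum>r<n. card (?F \<inter> one_shifted_column r)) + (n - 4) * card (?F \<inter> rungs)"
    by (rule sum_matching_multiplicities) blast
  also have "\<dots> \<le> 2 * (\<Sum>r<n. ?k) + 1 * (\<Sum>r<n. ?k) + (n - 4) * ?k"
    using le perfect_rungs perfect_one_rung_column perfect_one_shifted_column
    by (intro add_mono mult_left_mono sum_mono) auto
  also have "\<dots> = (3 * n + (n - 4)) * ?k"
    by (simp add: algebra_simps)
  finally show ?thesis .
qed

section \<open>Upper bounds from independent sets\<close>

lemma independent_setI:
  assumes "S \<subseteq> {..<m} \<times> {..<n}"
    and "\<And>i j. j < n \<Longrightarrow> (i, j) \<in> S \<Longrightarrow> (i, Suc j mod n) \<in> S \<Longrightarrow> False"
    and "\<And>i j. (i, j) \<in> S \<Longrightarrow> (Suc i, j) \<in> S \<Longrightarrow> False"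
  shows "independent_set cylinder S"
  unfolding independent_set_def
proof (intro conjI ballI notI)
  show "S \<subseteq> verts cylinder"
    using assms(1) by (simp add: verts_cylinder)
  fix e assume e: "e \<in> edges cylinder" "e \<subseteq> S"
  show False
    using e(1)
  proof (cases rule: cylinder_edge_cases)
    case (1 i j)
    then show ?thesis
      using assms(2)[of j i] e(2) by (auto simp: horizontal_def)
  next
    case (2 i j)
    then show ?thesis
      using assms(3)[of i j] e(2) by (auto simp: vertical_def)
  qed
qed

lemma card_incident_edges:
  assumes "independent_set cylinder S"
  shows "card (incident_edges cylinder S) = (\<Sum>v\<in>S. card {e \<in> edges cylinder. v \<in> e})"
proof -
  have "incident_edges cylinder S \<inter> edges cylinder = incident_edges cylinder S"
    by (auto simp: incident_edges_def)
  then show ?thesis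
    using card_incident_edges_Int[OF simple_graph_cylinder assms order_refl] by simp
qed

text \<open>The first and the last row are used in alternate columns, so the set stays independent also for
  \<open>m = 2\<close>, where these two rows are adjacent. The last column is left free: the cycle is odd, so
  the alternation cannot be closed up.\<close>

definition boundary_set :: "(nat \<times> nat) set" where
  "boundary_set = (\<lambda>j. (if even j then 0 else m - 1, j)) ` {..<n - 1}"

text \<open>Interior vertices of the last column have no neighbours in \<open>boundary_set\<close>, which avoids
  that column.\<close>

definition column_set :: "nat \<Rightarrow> (nat \<times> nat) set" where
  "column_set c = (\<lambda>t. (2 * t + 1, n - 1)) ` {..<c}"

text \<open>The checkerboard in the interior rows and all columns but the last: an independent set with
  \<open>(n - 1)/2\<close> vertices in each of these rows.\<close>

definition interior_set :: "(nat \<times> nat) set" where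
  "interior_set = (\<lambda>(i, t). (i, 2 * t + i mod 2)) ` ({1..<m - 1} \<times> {..<(n - 1) div 2})"

lemma card_boundary_set: "card boundary_set = n - 1"
  by (simp add: boundary_set_def card_image inj_on_def)

lemma card_column_set: "card (column_set c) = c"
  by (simp add: column_set_def card_image inj_on_def)

lemma card_interior_set: "card interior_set = (m - 2) * ((n - 1) div 2)"
proof -
  have "inj_on (\<lambda>(i, t). (i, 2 * t + i mod 2)) ({1..<m - 1} \<times> {..<(n - 1) div 2})"
    by (auto simp: inj_on_def)
  then have "card interior_set = (m - 1 - 1) * ((n - 1) div 2)"
    by (simp add: interior_set_def card_image)
  then show ?thesis
    by (simp add: numeral_2_eq_2)
qed

lemma independent_boundary_column:
  assumes "c \<le> m div 2 - 1"
  shows "independent_set cylinder (boundary_set \<union> column_set c)"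
proof (rule independent_setI)
  show "boundary_set \<union> column_set c \<subseteq> {..<m} \<times> {..<n}"
    using assms m_ge n_ge by (auto simp: boundary_set_def column_set_def)
  fix i j
  show False if "(i, j) \<in> boundary_set \<union> column_set c" "(Suc i, j) \<in> boundary_set \<union> column_set c"
    using that assms m_ge n_ge by (auto simp: boundary_set_def column_set_def split: if_splits) presburger+
  show False if "j < n" "(i, j) \<in> boundary_set \<union> column_set c"
    "(i, Suc j mod n) \<in> boundary_set \<union> column_set c"
    using that assms m_ge n_ge
    by (auto simp: Suc_mod_n boundary_set_def column_set_def split: if_splits)
qed

lemma independent_interior_set: "independent_set cylinder interior_set"
proof (rule independent_setI)
  have mem: "1 \<le> i \<and> i < m - 1 \<and> j < n - 1 \<and> (even i \<longleftrightarrow> even j)" if "(i, j) \<in> interior_set" for i j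
    using that by (auto simp: interior_set_def mod2_eq_if split: if_splits)
  show "interior_set \<subseteq> {..<m} \<times> {..<n}"
    using mem by fastforce
  fix i j
  show False if "(i, j) \<in> interior_set" "(Suc i, j) \<in> interior_set"
    using mem[OF that(1)] mem[OF that(2)] by auto
  show False if "j < n" "(i, j) \<in> interior_set" "(i, Suc j mod n) \<in> interior_set"
    using mem[OF that(2)] mem[OF that(3)] that(1) by (auto simp: Suc_mod_n split: if_splits)
qed

lemma degree_boundary:
  assumes "v \<in> boundary_set"
  shows "card {e \<in> edges cylinder. v \<in> e} = 3"
  using assms m_ge n_ge by (auto simp: boundary_set_def degree_cylinder)

lemma transversal_number_le_3d:
  assumes "1 \<le> d" "d \<le> n - 1"
  shows "transversal_number d cylinder \<le> 3 * d"
proof -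
  obtain S where S: "S \<subseteq> boundary_set" "card S = d"
    using assms obtain_subset_with_card_n[of d boundary_set] by (auto simp: card_boundary_set)
  have ind: "independent_set cylinder S"
    using independent_boundary_column[of 0] S(1) independent_set_mono by blast
  have "card (incident_edges cylinder S) = (\<Sum>v\<in>S. 3)"
    unfolding card_incident_edges[OF ind] using S degree_boundary by (intro sum.cong) auto
  moreover have "S \<noteq> {}"
    using S assms by auto
  ultimately show ?thesis
    using transversal_number_le[OF transversal_incident_edges[OF simple_graph_cylinder perfect_rungs ind]] S
    by simp
qed

lemma transversal_number_le_4d_plus_1:
  assumes "n \<le> d" "d \<le> n + m div 2 - 2"
  shows "transversal_number d cylinder + n \<le> 4 * d + 1"
proof -
  let ?c = "d - (n - 1)"
  let ?S = "boundary_set \<union> column_set ?c"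
  have c: "?c \<le> m div 2 - 1"
    using assms by linarith
  have ind: "independent_set cylinder ?S"
    by (rule independent_boundary_column[OF c])
  have fin: "finite boundary_set" "finite (column_set ?c)"
    by (auto simp: boundary_set_def column_set_def)
  have disj: "boundary_set \<inter> column_set ?c = {}"
    by (auto simp: boundary_set_def column_set_def)
  have card: "card ?S = d"
    using assms by (subst card_Un_disjoint[OF fin disj]) (simp add: card_boundary_set card_column_set)
  have "card {e \<in> edges cylinder. v \<in> e} = 4" if v: "v \<in> column_set ?c" for v
  proof -
    obtain t where "v = (2 * t + 1, n - 1)" "t < m div 2 - 1"
      using v c by (auto simp: column_set_def)
    then show ?thesis
      using n_ge by (subst \<open>v = _\<close>, subst degree_cylinder) auto
  qed
  then have "card (incident_edges cylinder ?S) = 3 * (n - 1) + 4 * ?c"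
    unfolding card_incident_edges[OF ind]
    by (subst sum.union_disjoint[OF fin disj]) (simp add: degree_boundary card_boundary_set card_column_set)
  moreover have "?S \<noteq> {}"
    using card assms n_ge by auto
  ultimately have "transversal_number d cylinder \<le> 3 * (n - 1) + 4 * ?c"
    using transversal_number_le[OF transversal_incident_edges[OF simple_graph_cylinder perfect_rungs ind]] card
    by simp
  then show ?thesis
    using assms n_ge by linarith
qed

text \<open>The complement of the edges incident with \<open>k\<close> independent interior vertices. The hypothesis
  \<open>n + m div 2 - 1 \<le> d\<close> says exactly that \<open>interior_set\<close> has at least \<open>k\<close> vertices.\<close>

lemma transversal_number_le_4d:
  assumes "1 \<le> d" "n + m div 2 - 1 \<le> d" "d \<le> m * n div 2"
  shows "transversal_number d cylinder + n \<le> 4 * d"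
proof -
  let ?k = "m * n div 2 - d"
  obtain p where "m = 2 * p"
    using even_m by (rule evenE)
  then obtain p' where p': "m = 2 * Suc p'"
    using m_ge by (cases p) auto
  obtain q where q: "n = 2 * q + 1"
    using odd_n by (rule oddE)
  have "m * n div 2 = Suc p' * n"
    using p' by simp
  then have "?k \<le> 2 * p' * q"
    using assms(2) p' q by simp
  then have "?k \<le> card interior_set"
    unfolding card_interior_set using p' q by simp
  then obtain S where S: "S \<subseteq> interior_set" "card S = ?k"
    using obtain_subset_with_card_n by metis
  have ind: "independent_set cylinder S"
    using independent_interior_set S(1) by (rule independent_set_mono)
  have "card {e \<in> edges cylinder. v \<in> e} = 4" if v: "v \<in> S" for v
  proof -
    obtain i t where "v = (i, 2 * t + i mod 2)" "1 \<le> i" "i < m - 1" "t < (n - 1) div 2"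
      using v S(1) by (auto simp: interior_set_def)
    moreover from this have "2 * t + i mod 2 < n"
      by (auto simp: mod2_eq_if)
    ultimately show ?thesis
      by (subst \<open>v = _\<close>, subst degree_cylinder) auto
  qed
  then have inc: "card (incident_edges cylinder S) = 4 * ?k"
    unfolding card_incident_edges[OF ind] using S by simp
  have "transversal_number d cylinder \<le> card (edges cylinder - incident_edges cylinder S)"
    using transversal_non_incident_edges[OF simple_graph_cylinder perfect_rungs ind] S assms
    by (intro transversal_number_le) (auto simp: card_matching_number)
  also have "\<dots> = card (edges cylinder) - 4 * ?k"
    using finite_edges[OF simple_graph_cylinder]
    by (subst card_Diff_subset) (auto simp: incident_edges_def inc[unfolded incident_edges_def] intro: finite_subset)
  finally have "transversal_number d cylinder \<le> card (edges cylinder) - 4 * ?k" .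
  moreover have "card (edges cylinder) + n = 4 * (m * n div 2)"
    using card_edges_cylinder p' by simp
  moreover have "4 * ?k \<le> card (edges cylinder)"
    using inc finite_edges[OF simple_graph_cylinder]
    by (metis (no_types, lifting) card_mono incident_edges_def mem_Collect_eq subsetI)
  ultimately show ?thesis
    using assms by linarith
qed

section \<open>The transversal numbers\<close>

lemma transversal_number_ge_3d:
  assumes "1 \<le> d" "d \<le> m * n div 2"
  shows "3 * d \<le> transversal_number d cylinder"
  using assms transversal_card_ge_3d transversal_number_attained[OF simple_graph_cylinder]
  by (metis card_matching_number(2))

text \<open>The averaging bound for an optimal \<open>T\<close>, over the integers so that it can be solved for
  \<open>|T|\<close> without truncated differences.\<close>

lemma transversal_number_complement:
  assumes "1 \<le> d" "d \<le> m * n div 2"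
  shows "int (n - 1) * (2 * int m * int n - int n - int (transversal_number d cylinder))
    \<le> int (3 * n + (n - 4)) * (int (m * n div 2) - int d)"
proof -
  obtain T where T: "transversal_set d cylinder T" "card T = transversal_number d cylinder"
    using assms transversal_number_attained[OF simple_graph_cylinder] by (metis card_matching_number(2))
  then have sub: "T \<subseteq> edges cylinder"
    by (simp add: transversal_set_def)
  moreover have "finite T"
    using sub finite_edges[OF simple_graph_cylinder] by (rule finite_subset)
  ultimately have "card (edges cylinder - T) + card T = card (edges cylinder)"
    using finite_edges[OF simple_graph_cylinder] by (simp add: card_Diff_subset card_mono)
  then have "int (card (edges cylinder - T)) = 2 * int m * int n - int n - int (transversal_number d cylinder)"
    using int_card_edges_cylinder T(2) by linarith
  moreover have "int (m * n div 2 - d) = int (m * n div 2) - int d"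
    using assms by simp
  moreover have "int ((n - 1) * card (edges cylinder - T)) \<le> int ((3 * n + (n - 4)) * (m * n div 2 - d))"
    using transversal_complement_card[OF T(1)] by (simp only: of_nat_le_iff)
  ultimately show ?thesis
    by (simp only: of_nat_mult)
qed

lemma transversal_number_max: "int (transversal_number (m * n div 2) cylinder) = 2 * int m * int n - int n"
proof -
  have pos: "1 \<le> m * n div 2"
    using m_ge n_ge mult_le_mono[OF m_ge n_ge] by linarith
  have "int (n - 1) * (2 * int m * int n - int n - int (transversal_number (m * n div 2) cylinder)) \<le> 0"
    using transversal_number_complement[OF pos order_refl] by simp
  then have "2 * int m * int n - int n - int (transversal_number (m * n div 2) cylinder) \<le> 0"
    using n_ge by (simp add: mult_le_0_iff)
  moreover have "transversal_number (m * n div 2) cylinder \<le> card (edges cylinder)"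
    using pos edges_transversal_set[OF simple_graph_cylinder]
    by (intro transversal_number_le) (simp add: card_matching_number)
  then have "int (transversal_number (m * n div 2) cylinder) + int n \<le> 2 * int m * int n"
    using int_card_edges_cylinder by linarith
  ultimately show ?thesis
    by linarith
qed

text \<open>For \<open>n \<ge> 5\<close> the averaging bound reads \<open>|E - T| \<le> 4k\<close>, that is, \<open>|T| \<ge> 4d - n\<close>, and
  both floors are nonnegative. For \<open>n = 3\<close> it reads \<open>2|E - T| \<le> 9k\<close> and gives the second floor,
  \<open>k/2\<close> rounded down; the first floor is \<open>d - 3\<close>, which turns the claim into
  \<open>|T| \<ge> 3d\<close>.\<close>

lemma transversal_number_lower:
  assumes d: "n \<le> d" "d \<le> m * n div 2"
  shows "4 * int d - int n
     - min \<lfloor>(real d - real n) / (real n - 2)\<rfloor> \<lfloor>(real m * real n - 2 * real d) / (2 * real n - 2)\<rfloor>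
     \<le> int (transversal_number d cylinder)"
proof -
  define k where "k = int (m * n div 2) - int d"
  define \<tau> where "\<tau> = int (transversal_number d cylinder)"
  have "m * n = 2 * (m * n div 2)"
    using even_m by simp
  then have mn: "int m * int n = 2 * int (m * n div 2)" "real m * real n = 2 * real (m * n div 2)"
    by (metis of_nat_mult of_nat_numeral)+
  have mn_real: "real m * real n - 2 * real d = 2 * of_int k"
    using mn(2) by (simp add: k_def)
  have k: "0 \<le> k"
    using d by (simp add: k_def)
  have "1 \<le> d"
    using d n_ge by linarith
  have F: "int (n - 1) * (4 * (k + int d) - int n - \<tau>) \<le> int (3 * n + (n - 4)) * k"
    using transversal_number_complement[OF \<open>1 \<le> d\<close> d(2)] mn(1) by (simp add: k_def \<tau>_def mult.assoc)
  show ?thesis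
  proof (cases "n = 3")
    case True
    have "3 * int d \<le> \<tau>"
      using transversal_number_ge_3d[OF \<open>1 \<le> d\<close> d(2)] by (simp add: \<tau>_def)
    moreover have "\<lfloor>(real d - real n) / (real n - 2)\<rfloor> = int d - 3"
      using True by (simp add: floor_diff_of_int[of "real d" 3, simplified])
    moreover have "4 * int d - 3 - \<tau> \<le> \<lfloor>of_int k / (2 :: real)\<rfloor>"
      using F True by (simp add: le_floor_iff)
    moreover have "(real m * real n - 2 * real d) / (2 * real n - 2) = of_int k / 2"
      using mn_real True by simp
    ultimately show ?thesis
      unfolding \<tau>_def[symmetric] using True by (simp only: min_def of_nat_numeral split: if_split) linarith
  next
    case False
    then have "5 \<le> n"
      using n_ge odd_n by (cases "n = 4") auto
    then have "int (3 * n + (n - 4)) = int (n - 1) * 4"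
      by simp
    then have "int (n - 1) * (4 * (k + int d) - int n - \<tau>) \<le> int (n - 1) * (4 * k)"
      using F by (simp add: mult.assoc)
    then have "4 * int d - int n \<le> \<tau>"
      using n_ge by (simp add: mult_le_cancel_left)
    moreover have "0 \<le> \<lfloor>(real d - real n) / (real n - 2)\<rfloor>"
      using d n_ge by simp
    moreover have "0 \<le> \<lfloor>(real m * real n - 2 * real d) / (2 * real n - 2)\<rfloor>"
      using mn_real k n_ge by simp
    ultimately show ?thesis
      unfolding \<tau>_def by linarith
  qed
qed

end

theorem theorem3p12:
  fixes m n d :: nat
  assumes "even m" and "odd n"
  shows
    "(n \<ge> 3 \<longrightarrow> 1 \<le> d \<and> d \<le> n \<longrightarrow>
        transversal_number d (path_graph 2 \<box> cycle_graph n) = 3 * d) \<and>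
     (m \<ge> 4 \<and> n \<ge> 3 \<longrightarrow>
        (1 \<le> d \<and> d \<le> n - 1 \<longrightarrow>
           transversal_number d (path_graph m \<box> cycle_graph n) = 3 * d) \<and>
        (n \<le> d \<and> d \<le> n + m div 2 - 2 \<longrightarrow>
           4 * int d - int n
             - min \<lfloor>(real d - real n) / (real n - 2)\<rfloor>
                   \<lfloor>(real m * real n - 2 * real d) / (2 * real n - 2)\<rfloor>
             \<le> int (transversal_number d (path_graph m \<box> cycle_graph n)) \<and>
           int (transversal_number d (path_graph m \<box> cycle_graph n)) \<le> 4 * int d - int n + 1) \<and>
        (n + m div 2 - 1 \<le> d \<and> d < m * n div 2 \<longrightarrow>
           4 * int d - int n
             - min \<lfloor>(real d - real n) / (real n - 2)\<rfloor>
                   \<lfloor>(real m * real n - 2 * real d) / (2 * real n - 2)\<rfloor>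
             \<le> int (transversal_number d (path_graph m \<box> cycle_graph n)) \<and>
           int (transversal_number d (path_graph m \<box> cycle_graph n)) \<le> 4 * int d - int n) \<and>
        int (transversal_number (m * n div 2) (path_graph m \<box> cycle_graph n))
          = 2 * int m * int n - int n)"
proof -
  have main: "1 \<le> d \<and> d \<le> n - 1 \<longrightarrow> transversal_number d (path_graph m' \<box> cycle_graph n) = 3 * d"
    if "odd_cylinder m' n" for m'
  proof -
    interpret odd_cylinder m' n by (rule that)
    have "2 * n \<le> m' * n"
      using m_ge by simp
    then have "d \<le> n - 1 \<Longrightarrow> d \<le> m' * n div 2"
      by linarith
    then show ?thesis
      using transversal_number_le_3d transversal_number_ge_3d
      by (auto simp: cylinder_def intro: antisym)
  qed
  show ?thesis
  proof (rule conjI; intro impI)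
    assume n: "n \<ge> 3" and d: "1 \<le> d \<and> d \<le> n"
    interpret odd_cylinder 2 n
      using n assms by unfold_locales auto
    show "transversal_number d (path_graph 2 \<box> cycle_graph n) = 3 * d"
    proof (cases "d = n")
      case True
      \<comment> \<open>The cubic prism has \<open>3n\<close> edges, all of which are needed.\<close>
      then show ?thesis
        using transversal_number_max by (simp add: cylinder_def)
    next
      case False
      then have "d \<le> n - 1"
        using d by linarith
      then show ?thesis
        using main[OF odd_cylinder_axioms] d by blast
    qed
  next
    assume mn: "m \<ge> 4 \<and> n \<ge> 3"
    interpret odd_cylinder m n
      using mn assms by unfold_locales auto
    obtain p where p: "m = 2 * p" "2 \<le> p"
      using even_m mn by (auto elim!: evenE)
    have "n + m div 2 - 2 \<le> m * n div 2"
    proof -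
      obtain p' n' where "p = Suc p'" "n = Suc n'"
        using p mn by (metis Suc_le_D le_trans numeral_2_eq_2 numeral_3_eq_3)
      then show ?thesis
        using p by simp
    qed
    then show "(1 \<le> d \<and> d \<le> n - 1 \<longrightarrow>
           transversal_number d (path_graph m \<box> cycle_graph n) = 3 * d) \<and>
        (n \<le> d \<and> d \<le> n + m div 2 - 2 \<longrightarrow>
           4 * int d - int n
             - min \<lfloor>(real d - real n) / (real n - 2)\<rfloor>
                   \<lfloor>(real m * real n - 2 * real d) / (2 * real n - 2)\<rfloor>
             \<le> int (transversal_number d (path_graph m \<box> cycle_graph n)) \<and>
           int (transversal_number d (path_graph m \<box> cycle_graph n)) \<le> 4 * int d - int n + 1) \<and>
        (n + m div 2 - 1 \<le> d \<and> d < m * n div 2 \<longrightarrow>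
           4 * int d - int n
             - min \<lfloor>(real d - real n) / (real n - 2)\<rfloor>
                   \<lfloor>(real m * real n - 2 * real d) / (2 * real n - 2)\<rfloor>
             \<le> int (transversal_number d (path_graph m \<box> cycle_graph n)) \<and>
           int (transversal_number d (path_graph m \<box> cycle_graph n)) \<le> 4 * int d - int n) \<and>
        int (transversal_number (m * n div 2) (path_graph m \<box> cycle_graph n))
          = 2 * int m * int n - int n"
      using main[OF odd_cylinder_axioms] transversal_number_lower[of d]
        transversal_number_le_4d_plus_1[of d] transversal_number_le_4d[of d] transversal_number_max p mn
      unfolding cylinder_def by force
  qed
qed

end
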